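(* The following is true. (i) The set $\mathcal{P}$ is a maximal convex invertible cone of rational functions analytic in $\mathbb{C}_+$; that is, $\mathcal{P}$ is a convex invertible cone of rational functions analytic in $\mathbb{C}_+$, and it is not properly contained in any other convex invertible cone of rational functions analytic in $\mathbb{C}_+$. (ii) Let $g_+\in\mathcal{G}_+$, $g_-\in\mathcal{G}_-$ and $g_o\in\mathcal{G}_o$ be given. Then $\mathcal{G}_{g_+,g_-,g_o}$ is a maximal convex set of rational functions with prescribed poles and zeroes in $\mathbb{C}_+$; that is, it is a convex set whose nonzero members lie in $\tilde{\mathcal{G}}_{g_+}$, and it is maximal (with respect to inclusion) among convex sets of rational functions whose nonzero members lie in $\tilde{\mathcal{G}}_{g_+}$. In fact, if $\phi$ is a rational function with $\phi\notin\mathcal{G}_{g_+,g_-,g_o}$, one can always find $\psi\in\mathcal{G}_{g_+,g_-,g_o}$ so that $\phi+\psi\notin\tilde{\mathcal{G}}_{g_+}$.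
   Context: All functions are scalar rational functions of a complex variable $s$ with complex coefficients. $\mathbb{C}_+=\{s:\operatorname{Re}s>0\}$ and $\mathbb{C}_-=\{s:\operatorname{Re}s<0\}$ are the open right and left half planes, and $\overline{\mathbb{C}_-}=\mathbb{C}_-\cup i\mathbb{R}$. Poles and zeroes mean those in the finite complex plane. $\mathcal{P}$ (positive functions) is the set of rational functions $p$ which are analytic in $\mathbb{C}_+$ and satisfy $\operatorname{Re}p(s)\ge 0$ for all $s\in\mathbb{C}_+$ (the zero function is included). A convex invertible cone is a set closed under multiplication by positive scalars, under addition, and under inversion $f\mapsto 1/f$ (whenever the inverse exists, i.e. $f\not\equiv0$, it also belongs to the set). $\mathcal{G}_+$ (resp. $\mathcal{G}_-$) is the set of all nonzero rational functions all of whose poles and zeroes are in $\mathbb{C}_+$ (resp. in $\mathbb{C}_-$). $\mathcal{G}_o$ is the set of rational functions which, along with their inverses, are analytic in both open half planes, i.e. of the form $g_o(s)=c\prod_{j=1}^m(s-ir_j)^{\eta_j}$ with $m\ge0$, $r_j\in\mathbb{R}$ distinct, $\eta_j$ integers (positive or negative), and $c\in\mathbb{C}$, $c\neq 0$ (empty product equal to $1$). For $g_+\in\mathcal{G}_+$, $$\tilde{\mathcal{G}}_{g_+}:=\left\{\frac{n_-(s)}{d_-(s)}g_+(s): n_-,d_-\text{ nonzero polynomials with all roots in }\overline{\mathbb{C}_-}\right\}.$$ For $g_+\in\mathcal{G}_+$, $g_-\in\mathcal{G}_-$, $g_o\in\mathcal{G}_o$, $$\mathcal{G}_{g_+,g_-,g_o}:=\{g_+(s)p(s)g_o(s)g_-(s):p\in\mathcal{P}\}.$$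 *)

theory Defs
  imports
    "HOL-Complex_Analysis.Complex_Analysis"
    "HOL-Computational_Algebra.Fundamental_Theorem_Algebra"
    "HOL-Computational_Algebra.Polynomial_Factorial"
    "HOL-Computational_Algebra.Field_as_Ring"
begin

text \<open>
  Rational functions are elements of the fraction field of \<open>complex poly\<close>, so that equality,
  sums, products and inverses are those of the field of rational functions (common factors
  cancel).  \<open>quot_of_fract f\<close> is the representation of \<open>f\<close> in lowest terms.
\<close>

type_synonym ratfun = "complex poly fract"

definition rat_const :: "complex \<Rightarrow> ratfun" where
  "rat_const c = to_fract [:c:]"

definition rat_poles :: "ratfun \<Rightarrow> complex set" where
  "rat_poles f = {s. poly (snd (quot_of_fract f)) s = 0}"

definition rat_zeroes :: "ratfun \<Rightarrow> complex set" where
  "rat_zeroes f = {s. poly (fst (quot_of_fract f)) s = 0}"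

text \<open>
  The value at a pole is the junk value 0, because of \<open>x / 0 = 0\<close>.  It does not matter below:
  values are only used where the function is required to be analytic, and
  \<open>rat_eval_analytic_on_iff\<close> shows that analyticity excludes poles.
\<close>

definition rat_eval :: "ratfun \<Rightarrow> complex \<Rightarrow> complex" where
  "rat_eval f s = poly (fst (quot_of_fract f)) s / poly (snd (quot_of_fract f)) s"

definition C_plus :: "complex set" where
  "C_plus = {s. Re s > 0}"

definition C_minus :: "complex set" where
  "C_minus = {s. Re s < 0}"

definition rat_analytic_C_plus :: "ratfun set" where
  "rat_analytic_C_plus = {f. rat_eval f analytic_on C_plus}"

definition positive_functions :: "ratfun set" where
  "positive_functions =
     {p. rat_eval p analytic_on C_plus \<and> (\<forall>s\<in>C_plus. Re (rat_eval p s) \<ge> 0)}"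

definition convex_invertible_cone :: "ratfun set \<Rightarrow> bool" where
  "convex_invertible_cone A \<longleftrightarrow>
     (\<forall>f\<in>A. \<forall>t::real. t > 0 \<longrightarrow> rat_const (of_real t) * f \<in> A) \<and>
     (\<forall>f\<in>A. \<forall>g\<in>A. f + g \<in> A) \<and>
     (\<forall>f\<in>A. f \<noteq> 0 \<longrightarrow> inverse f \<in> A)"

text \<open>The library's \<open>convex\<close> needs a \<open>real_vector\<close> instance, which \<open>fract\<close> does not have.\<close>

definition rat_convex :: "ratfun set \<Rightarrow> bool" where
  "rat_convex A \<longleftrightarrow>
     (\<forall>f\<in>A. \<forall>g\<in>A. \<forall>u v::real. u \<ge> 0 \<longrightarrow> v \<ge> 0 \<longrightarrow> u + v = 1 \<longrightarrow>
        rat_const (of_real u) * f + rat_const (of_real v) * g \<in> A)"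

definition G_plus :: "ratfun set" where
  "G_plus = {g. g \<noteq> 0 \<and> rat_poles g \<subseteq> C_plus \<and> rat_zeroes g \<subseteq> C_plus}"

definition G_minus :: "ratfun set" where
  "G_minus = {g. g \<noteq> 0 \<and> rat_poles g \<subseteq> C_minus \<and> rat_zeroes g \<subseteq> C_minus}"

text \<open>
  The explicit form \<open>c * (\<Prod>j. (s - i r\<^sub>j) powi \<eta>\<^sub>j)\<close>; the finite set \<open>R\<close> consists of
  the distinct reals \<open>r\<^sub>j\<close>.  Lemma \<open>G_o_iff\<close> gives the description by analyticity.
\<close>

definition G_o :: "ratfun set" where
  "G_o = {g. \<exists>c R \<eta>. c \<noteq> 0 \<and> finite R \<and>
     g = rat_const c * (\<Prod>r\<in>R. to_fract [:- (\<i> * of_real r), 1:] powi (\<eta> (r::real)))}"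

definition G_tilde :: "ratfun \<Rightarrow> ratfun set" where
  "G_tilde gp = {to_fract n / to_fract d * gp | n d. n \<noteq> 0 \<and> d \<noteq> 0 \<and>
     (\<forall>s. poly n s = 0 \<longrightarrow> Re s \<le> 0) \<and> (\<forall>s. poly d s = 0 \<longrightarrow> Re s \<le> 0)}"

definition G_set :: "ratfun \<Rightarrow> ratfun \<Rightarrow> ratfun \<Rightarrow> ratfun set" where
  "G_set gp gm go = {gp * p * go * gm | p. p \<in> positive_functions}"

subsection \<open>Consistency facts\<close>

lemma quot_of_fract_repr:
  fixes f :: ratfun
  shows "f = to_fract (fst (quot_of_fract f)) / to_fract (snd (quot_of_fract f))"
    and "snd (quot_of_fract f) \<noteq> 0"
    and "coprime (fst (quot_of_fract f)) (snd (quot_of_fract f))"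
proof -
  have "f = quot_to_fract (quot_of_fract f)" by simp
  also have "\<dots> = to_fract (fst (quot_of_fract f)) / to_fract (snd (quot_of_fract f))"
    by (simp add: quot_to_fract_def Fract_conv_to_fract case_prod_unfold)
  finally show "f = to_fract (fst (quot_of_fract f)) / to_fract (snd (quot_of_fract f))" .
  show "snd (quot_of_fract f) \<noteq> 0" by simp
  show "coprime (fst (quot_of_fract f)) (snd (quot_of_fract f))"
    by (rule coprime_quot_of_fract)
qed

lemma rat_zeroes_poles_disjoint: "rat_zeroes f \<inter> rat_poles f = {}"
  using quot_of_fract_repr(3)[of f] coprime_poly_0
  by (auto simp: rat_zeroes_def rat_poles_def)

lemma quot_of_fract_cross:
  assumes "b \<noteq> 0"
  shows "fst (quot_of_fract (to_fract a / to_fract b :: ratfun)) * b =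
         a * snd (quot_of_fract (to_fract a / to_fract b))"
proof -
  let ?f = "to_fract a / to_fract b :: ratfun"
  have "to_fract (fst (quot_of_fract ?f)) / to_fract (snd (quot_of_fract ?f)) = ?f"
    using quot_of_fract_repr(1)[of ?f] by simp
  then have "to_fract (fst (quot_of_fract ?f) * b) = to_fract (a * snd (quot_of_fract ?f))"
    using assms quot_of_fract_repr(2)[of ?f] by (simp add: frac_eq_eq del: to_fract_mult add: to_fract_mult[symmetric])
  then show ?thesis by (simp only: to_fract_eq_iff)
qed

lemma rat_eval_quotient:
  assumes "poly b s \<noteq> 0"
  shows "rat_eval (to_fract a / to_fract b) s = poly a s / poly b s"
proof -
  let ?q = "quot_of_fract (to_fract a / to_fract b :: ratfun)"
  have b: "b \<noteq> 0" using assms by auto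
  have eq: "poly (fst ?q) s * poly b s = poly a s * poly (snd ?q) s"
    using quot_of_fract_cross[OF b, of a] by (metis poly_mult)
  have "poly (snd ?q) s \<noteq> 0"
  proof
    assume 0: "poly (snd ?q) s = 0"
    then have "poly (fst ?q) s = 0" using eq assms by simp
    then show False
      using 0 quot_of_fract_repr(3) coprime_poly_0 by blast
  qed
  then show ?thesis using eq assms by (simp add: rat_eval_def frac_eq_eq)
qed

lemma rat_poles_quotient:
  assumes "b \<noteq> 0" "s \<in> rat_poles (to_fract a / to_fract b)"
  shows "poly b s = 0"
proof -
  let ?q = "quot_of_fract (to_fract a / to_fract b :: ratfun)"
  have "poly (fst ?q) s * poly b s = poly a s * poly (snd ?q) s"
    using quot_of_fract_cross[OF assms(1), of a] by (metis poly_mult)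
  moreover have "poly (snd ?q) s = 0" using assms(2) by (simp add: rat_poles_def)
  moreover from this have "poly (fst ?q) s \<noteq> 0"
    using quot_of_fract_repr(3) coprime_poly_0 by blast
  ultimately show ?thesis by simp
qed

lemma rat_poles_mult: "rat_poles (f * g) \<subseteq> rat_poles f \<union> rat_poles g"
proof
  fix s assume s: "s \<in> rat_poles (f * g)"
  let ?a = "fst (quot_of_fract f)" and ?b = "snd (quot_of_fract f)"
  let ?c = "fst (quot_of_fract g)" and ?d = "snd (quot_of_fract g)"
  have "f * g = to_fract (?a * ?c) / to_fract (?b * ?d)"
    using quot_of_fract_repr(1)[of f] quot_of_fract_repr(1)[of g]
    by (metis times_divide_times_eq to_fract_mult)
  then have "poly (?b * ?d) s = 0"
    using rat_poles_quotient[of "?b * ?d" s "?a * ?c"] s quot_of_fract_repr(2) by simp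
  then show "s \<in> rat_poles f \<union> rat_poles g" by (auto simp: rat_poles_def)
qed

lemma rat_eval_analytic_on_iff: "rat_eval f analytic_on S \<longleftrightarrow> rat_poles f \<inter> S = {}"
proof
  let ?n = "fst (quot_of_fract f)" and ?d = "snd (quot_of_fract f)"
  have eval: "rat_eval f = (\<lambda>s. poly ?n s / poly ?d s)" by (auto simp: rat_eval_def)
  have an: "(\<lambda>s. poly p s) analytic_on S" for p
    by (rule analytic_on_subset[of _ UNIV])
      (auto simp: analytic_on_open intro!: holomorphic_intros)
  show "rat_eval f analytic_on S" if "rat_poles f \<inter> S = {}"
    unfolding eval using that by (intro analytic_on_divide an) (auto simp: rat_poles_def)
  show "rat_poles f \<inter> S = {}" if analytic: "rat_eval f analytic_on S"
  proof (rule ccontr)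
    assume "rat_poles f \<inter> S \<noteq> {}"
    then obtain s where s: "s \<in> S" "poly ?d s = 0" by (auto simp: rat_poles_def)
    then have n: "poly ?n s \<noteq> 0"
      using quot_of_fract_repr(3) coprime_poly_0 by blast
    have "isCont (rat_eval f) s"
      using analytic s(1) analytic_at_imp_isCont analytic_on_analytic_at by blast
    then have "((\<lambda>z. rat_eval f z * poly ?d z) \<longlongrightarrow> rat_eval f s * poly ?d s) (at s)"
      by (intro tendsto_intros isContD) auto
    moreover have "eventually (\<lambda>z. rat_eval f z * poly ?d z = poly ?n z) (at s)"
    proof -
      have "finite ({z. poly ?d z = 0} - {s})"
        using poly_roots_finite[OF quot_of_fract_repr(2)[of f]] by simp
      then have "open (- ({z. poly ?d z = 0} - {s}))" by (intro open_Compl finite_imp_closed)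
      then have "eventually (\<lambda>z. z \<in> - ({z. poly ?d z = 0} - {s})) (at s)"
        by (intro eventually_at_in_open') auto
      moreover have "eventually (\<lambda>z. z \<noteq> s) (at s)" by (rule eventually_neq_at_within)
      ultimately show ?thesis by eventually_elim (auto simp: rat_eval_def)
    qed
    ultimately have "((\<lambda>z. poly ?n z) \<longlongrightarrow> 0) (at s)"
      using s(2) by (simp add: tendsto_cong)
    moreover have "((\<lambda>z. poly ?n z) \<longlongrightarrow> poly ?n s) (at s)"
      by (intro tendsto_intros)
    ultimately show False using n tendsto_unique[OF at_neq_bot] by blast
  qed
qed

lemma to_fract_eq_prod_roots:
  fixes p :: "complex poly" and R :: "real set"
  assumes "p \<noteq> 0" "finite R" "{z. poly p z = 0} \<subseteq> (\<lambda>r. \<i> * of_real r) ` R"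
  shows "to_fract p = rat_const (lead_coeff p) *
           (\<Prod>r\<in>R. to_fract [:- (\<i> * of_real r), 1:] ^ order (\<i> * of_real r) p)"
proof -
  let ?h = "\<lambda>r::real. \<i> * of_real r"
  have hom_power: "to_fract (q ^ k) = to_fract q ^ k" for q :: "complex poly" and k
    by (induction k) auto
  have hom_prod: "to_fract (\<Prod>r\<in>R. q r) = (\<Prod>r\<in>R. to_fract (q r))" for q :: "real \<Rightarrow> complex poly"
    by (induction R rule: infinite_finite_induct) auto
  have "(\<Prod>z|poly p z = 0. [:-z, 1:] ^ order z p) = (\<Prod>z\<in>?h ` R. [:-z, 1:] ^ order z p)"
    using assms by (intro prod.mono_neutral_left) (auto simp: order_root)
  also have "\<dots> = (\<Prod>r\<in>R. [:- ?h r, 1:] ^ order (?h r) p)"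
    by (subst prod.reindex) (auto simp: inj_on_def)
  finally have "p = [:lead_coeff p:] * (\<Prod>r\<in>R. [:- ?h r, 1:] ^ order (?h r) p)"
    using complex_poly_decompose[of p] by simp
  then have "to_fract p = to_fract ([:lead_coeff p:] * (\<Prod>r\<in>R. [:- ?h r, 1:] ^ order (?h r) p))"
    by (rule arg_cong)
  then show ?thesis by (simp only: to_fract_mult hom_prod hom_power rat_const_def)
qed

lemma G_o_iff:
  "g \<in> G_o \<longleftrightarrow> g \<noteq> 0 \<and> rat_eval g analytic_on C_plus \<union> C_minus \<and>
     rat_eval (inverse g) analytic_on C_plus \<union> C_minus"
proof -
  define H where "H = {g. g \<noteq> 0 \<and> rat_poles g \<subseteq> {s. Re s = 0} \<and> rat_poles (inverse g) \<subseteq> {s. Re s = 0}}"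
  have sub: "A \<inter> (C_plus \<union> C_minus) = {} \<longleftrightarrow> A \<subseteq> {s. Re s = 0}" for A
    unfolding C_plus_def C_minus_def using linorder_neq_iff by fastforce
  have H_mult: "f * g \<in> H" if "f \<in> H" "g \<in> H" for f g
    using that rat_poles_mult[of f g] rat_poles_mult[of "inverse f" "inverse g"]
    unfolding H_def by (auto simp: inverse_mult_distrib)
  have H_inverse: "inverse f \<in> H" if "f \<in> H" for f
    using that by (auto simp: H_def)
  have const: "rat_poles (to_fract [:c:]) = {}" for c
    by (auto simp: rat_poles_def)
  have inv_const: "inverse (to_fract [:c:]) = to_fract [:inverse c:]" if "c \<noteq> 0" for c :: complex
    by (rule inverse_unique) (use that in \<open>simp flip: to_fract_mult add: one_pCons[symmetric]\<close>)
  have H_const: "rat_const c \<in> H" if "c \<noteq> 0" for c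
    using that by (auto simp: H_def rat_const_def inv_const const)
  have H_1: "1 \<in> H" using H_const[of 1] by (simp add: rat_const_def flip: one_pCons)
  have H_power: "f ^ k \<in> H" if "f \<in> H" for f k
    by (induction k) (use H_1 H_mult that in auto)
  have H_power_int: "f powi k \<in> H" if "f \<in> H" for f k
    using H_power H_inverse that by (auto simp: power_int_def)
  have H_linear: "to_fract [:- (\<i> * of_real r), 1:] \<in> H" for r
  proof -
    have "Re s = 0" if "s \<in> rat_poles (1 / to_fract [:- (\<i> * of_real r), 1:])" for s
    proof -
      have "s = \<i> * of_real r"
        using rat_poles_quotient[of "[:- (\<i> * of_real r), 1:]" s 1] that by simp
      then show ?thesis by simp
    qed
    then have "rat_poles (1 / to_fract [:- (\<i> * of_real r), 1:]) \<subseteq> {s. Re s = 0}"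
      by blast
    then show ?thesis by (auto simp: H_def rat_poles_def divide_inverse)
  qed
  have "g \<in> H" if "g \<in> G_o"
  proof -
    obtain c R \<eta> where c: "c \<noteq> 0" and R: "finite R" and
      g: "g = rat_const c * (\<Prod>r\<in>R. to_fract [:- (\<i> * of_real r), 1:] powi (\<eta> (r::real)))"
      using \<open>g \<in> G_o\<close> by (auto simp: G_o_def)
    have "(\<Prod>r\<in>R. to_fract [:- (\<i> * of_real r), 1:] powi (\<eta> r)) \<in> H"
      using R by induction (use H_1 H_mult H_power_int H_linear in auto)
    then show ?thesis using H_mult H_const c g by blast
  qed
  moreover have "g \<in> G_o" if "g \<in> H"
  proof -
    let ?n = "fst (quot_of_fract g)" and ?d = "snd (quot_of_fract g)"
    let ?h = "\<lambda>r::real. \<i> * of_real r"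
    let ?L = "\<lambda>r. to_fract [:- ?h r, 1:]"
    have g: "g = to_fract ?n / to_fract ?d" by (rule quot_of_fract_repr)
    have d: "?d \<noteq> 0" by (rule quot_of_fract_repr)
    have n: "?n \<noteq> 0" using g \<open>g \<in> H\<close> by (auto simp: H_def)
    have droot: "Re z = 0" if "poly ?d z = 0" for z
      using that \<open>g \<in> H\<close> by (auto simp: H_def rat_poles_def)
    have nroot: "Re z = 0" if z: "poly ?n z = 0" for z
    proof -
      let ?q = "quot_of_fract (to_fract ?d / to_fract ?n)"
      have "poly (fst ?q) z * poly ?n z = poly ?d z * poly (snd ?q) z"
        using quot_of_fract_cross[OF n, of ?d] by (metis poly_mult)
      moreover have "poly ?d z \<noteq> 0"
        using z quot_of_fract_repr(3) coprime_poly_0 by blast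
      ultimately have "poly (snd ?q) z = 0" using z by simp
      moreover have "inverse g = to_fract ?d / to_fract ?n" by (subst g) simp
      ultimately show ?thesis using \<open>g \<in> H\<close> by (auto simp: H_def rat_poles_def)
    qed
    define R where "R = Im ` ({z. poly ?n z = 0} \<union> {z. poly ?d z = 0})"
    have R: "finite R"
      unfolding R_def using poly_roots_finite[OF n] poly_roots_finite[OF d] by simp
    have im: "z = ?h (Im z)" if "Re z = 0" for z
      using that by (simp add: complex_eq_iff)
    have incl: "A \<subseteq> ?h ` R" if "A \<subseteq> {z. poly ?n z = 0} \<union> {z. poly ?d z = 0}" for A
    proof
      fix z assume "z \<in> A"
      with that have z: "z \<in> {z. poly ?n z = 0} \<union> {z. poly ?d z = 0}" by (rule subsetD)
      then have "Re z = 0" using nroot droot by auto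
      then have "z = ?h (Im z)" by (rule im)
      then show "z \<in> ?h ` R" using z unfolding R_def by (intro image_eqI[of _ ?h "Im z"] imageI)
    qed
    have nR: "{z. poly ?n z = 0} \<subseteq> ?h ` R" and dR: "{z. poly ?d z = 0} \<subseteq> ?h ` R"
      by (rule incl, rule Un_upper1, rule incl, rule Un_upper2)
    have quot: "rat_const (a / b) = rat_const a / rat_const b" if "b \<noteq> 0" for a b
    proof -
      have "rat_const (a / b) * rat_const b = rat_const a"
        using that by (simp add: rat_const_def flip: to_fract_mult)
      moreover have "rat_const b \<noteq> 0" using that by (simp add: rat_const_def)
      ultimately show ?thesis by (simp add: eq_divide_eq)
    qed
    have split: "(a * x) / (b * y) = (a / b) * (x / y)" for a b x y :: ratfun
      by simp
    note g
    also have "to_fract ?n / to_fract ?d = rat_const (lead_coeff ?n / lead_coeff ?d) *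
        ((\<Prod>r\<in>R. ?L r ^ order (?h r) ?n) / (\<Prod>r\<in>R. ?L r ^ order (?h r) ?d))"
      unfolding to_fract_eq_prod_roots[OF n R nR] to_fract_eq_prod_roots[OF d R dR] split
      using d by (simp only: quot leading_coeff_0_iff not_False_eq_True)
    also have "(\<Prod>r\<in>R. ?L r ^ order (?h r) ?n) / (\<Prod>r\<in>R. ?L r ^ order (?h r) ?d) =
        (\<Prod>r\<in>R. ?L r powi (int (order (?h r) ?n) - int (order (?h r) ?d)))"
      unfolding prod_dividef[symmetric] by (intro prod.cong refl) (simp add: power_int_diff)
    finally have eq: "g = rat_const (lead_coeff ?n / lead_coeff ?d) *
        (\<Prod>r\<in>R. ?L r powi (int (order (?h r) ?n) - int (order (?h r) ?d)))" .
    have "lead_coeff ?n / lead_coeff ?d \<noteq> 0" using n d by simp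
    have intro: "g \<in> G_o" if "c \<noteq> 0" "g = rat_const c * (\<Prod>r\<in>R. ?L r powi \<eta> r)" for c \<eta>
      unfolding G_o_def by (intro CollectI exI conjI) (rule that R)+
    show ?thesis by (rule intro[OF _ eq]) fact
  qed
  ultimately have "g \<in> G_o \<longleftrightarrow> g \<in> H" by (rule iffI)
  then show ?thesis
    by (simp only: rat_eval_analytic_on_iff sub H_def mem_Collect_eq)
qed

end

theory Submission
  imports Defs
begin

text \<open>
  The open mapping theorem shows that a nonzero positive function has no zero in the open right
  half plane, which makes the positive functions closed under inversion.  If \<open>f\<close> is not
  positive, then either \<open>f\<close> has a pole in the right half plane or \<open>Re (f s) < 0\<close> for some
  \<open>s\<close> there; in the latter case some positive \<open>p\<close> takes the value \<open>- f s\<close> at \<open>s\<close>,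
  and \<open>p\<close> can be chosen with \<open>f + p \<noteq> 0\<close>.  Either way \<open>f + p\<close> acquires a pole or a zero in
  the right half plane, so \<open>f\<close> cannot be adjoined.  Part (ii) is the same argument after
  division by \<open>g\<^sub>+ g\<^sub>o g\<^sub>-\<close>.
\<close>

section \<open>Poles and values of sums, products and inverses\<close>

lemma rat_poles_quotient': "poly b s \<noteq> 0 \<Longrightarrow> s \<notin> rat_poles (to_fract a / to_fract b)"
  using rat_poles_quotient[of b s a] by fastforce

lemma not_in_rat_polesE:
  assumes "s \<notin> rat_poles f"
  obtains a b where "f = to_fract a / to_fract b" "poly b s \<noteq> 0"
  by (rule that[OF quot_of_fract_repr(1)]) (use assms in \<open>simp add: rat_poles_def\<close>)

text \<open>The common denominator \<open>b * d\<close> does not vanish at \<open>s\<close>, which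
  settles analyticity and the value at once.\<close>

lemma rat_eval_add_aux:
  assumes "s \<notin> rat_poles f" "s \<notin> rat_poles g"
  shows "s \<notin> rat_poles (f + g) \<and> rat_eval (f + g) s = rat_eval f s + rat_eval g s"
proof -
  obtain a b where f: "f = to_fract a / to_fract b" and b: "poly b s \<noteq> 0"
    using assms(1) by (rule not_in_rat_polesE)
  obtain c d where g: "g = to_fract c / to_fract d" and d: "poly d s \<noteq> 0"
    using assms(2) by (rule not_in_rat_polesE)
  have "b \<noteq> 0" "d \<noteq> 0" using b d by auto
  then have "f + g = to_fract (a * d + c * b) / to_fract (b * d)"
    by (simp add: f g add_frac_eq)
  then show ?thesis
    using b d rat_poles_quotient'[of "b * d" s "a * d + c * b"]
      rat_eval_quotient[of "b * d" s "a * d + c * b"]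
    by (simp only: poly_mult poly_add mult_eq_0_iff) (simp add: rat_eval_quotient[OF b] rat_eval_quotient[OF d] f g add_frac_eq)
qed

lemmas rat_poles_add = conjunct1[OF rat_eval_add_aux]
lemmas rat_eval_add = conjunct2[OF rat_eval_add_aux]

lemma rat_eval_mult:
  assumes "s \<notin> rat_poles f" "s \<notin> rat_poles g"
  shows "rat_eval (f * g) s = rat_eval f s * rat_eval g s"
proof -
  obtain a b where f: "f = to_fract a / to_fract b" and b: "poly b s \<noteq> 0"
    using assms(1) by (rule not_in_rat_polesE)
  obtain c d where g: "g = to_fract c / to_fract d" and d: "poly d s \<noteq> 0"
    using assms(2) by (rule not_in_rat_polesE)
  have "f * g = to_fract (a * c) / to_fract (b * d)"
    by (simp add: f g)
  then show ?thesis
    using b d by (simp add: rat_eval_quotient f g del: to_fract_mult)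
qed

lemma rat_poles_to_fract [simp]: "rat_poles (to_fract a) = {}"
  using rat_poles_quotient'[of 1 _ a] by auto

lemma rat_eval_to_fract [simp]: "rat_eval (to_fract a) s = poly a s"
  using rat_eval_quotient[of 1 s a] by simp

lemma rat_poles_const [simp]: "rat_poles (rat_const c) = {}"
  by (simp add: rat_const_def)

lemma rat_eval_const [simp]: "rat_eval (rat_const c) s = c"
  by (simp add: rat_const_def)

lemma rat_const_0 [simp]: "rat_const 0 = 0"
  by (simp add: rat_const_def)

lemma rat_const_1 [simp]: "rat_const 1 = 1"
  by (simp add: rat_const_def flip: one_pCons)

lemma rat_const_mult: "rat_const (a * b) = rat_const a * rat_const b"
  by (simp add: rat_const_def flip: to_fract_mult)

lemma inverse_rat_const: "inverse (rat_const c) = rat_const (inverse c)"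
proof (cases "c = 0")
  case False
  then have "rat_const c * rat_const (inverse c) = 1"
    by (simp flip: rat_const_mult)
  then show ?thesis by (rule inverse_unique)
qed simp

text \<open>If both \<open>f\<close> and its inverse are analytic at \<open>s\<close>, their values
  there multiply to 1. Conversely, in \<open>f = a / b\<close> with \<open>b\<close> nonzero at
  \<open>s\<close>, a nonzero value makes \<open>a\<close> nonzero at \<open>s\<close>, so
  \<open>b / a\<close> is analytic there.\<close>

lemma not_in_rat_poles_inverse_iff:
  assumes "f \<noteq> 0" "s \<notin> rat_poles f"
  shows "s \<notin> rat_poles (inverse f) \<longleftrightarrow> rat_eval f s \<noteq> 0"
proof
  assume "s \<notin> rat_poles (inverse f)"
  then have "rat_eval (f * inverse f) s = rat_eval f s * rat_eval (inverse f) s"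
    by (intro rat_eval_mult assms)
  moreover have "rat_eval (f * inverse f) s = 1"
    using assms(1) rat_eval_const[of 1 s] by simp
  ultimately show "rat_eval f s \<noteq> 0" by auto
next
  assume neq: "rat_eval f s \<noteq> 0"
  obtain a b where f: "f = to_fract a / to_fract b" and b: "poly b s \<noteq> 0"
    using assms(2) by (rule not_in_rat_polesE)
  have "poly a s \<noteq> 0" using neq b by (auto simp: f rat_eval_quotient)
  then show "s \<notin> rat_poles (inverse f)" by (simp add: f rat_poles_quotient')
qed

text \<open>In lowest terms numerator and denominator share no root. Hence a zero is a regular point
  with value 0, and at a pole of \<open>f\<close> the numerator is nonzero, which makes the inverse
  regular there.\<close>

lemma rat_poles_inverse:
  assumes "f \<noteq> 0"
  shows "rat_poles (inverse f) = rat_zeroes f"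
proof -
  have 1: "s \<in> rat_zeroes f \<longleftrightarrow> s \<notin> rat_poles f \<and> rat_eval f s = 0" for s
    using rat_zeroes_poles_disjoint[of f]
    by (auto simp: rat_zeroes_def rat_poles_def rat_eval_def)
  have 2: "s \<notin> rat_poles (inverse f)" if s: "s \<in> rat_poles f" for s
  proof -
    have "poly (fst (quot_of_fract f)) s \<noteq> 0"
      using s rat_zeroes_poles_disjoint[of f] by (auto simp: rat_zeroes_def)
    moreover have "inverse f = to_fract (snd (quot_of_fract f)) / to_fract (fst (quot_of_fract f))"
      by (subst quot_of_fract_repr(1)[of f]) simp
    ultimately show ?thesis by (metis rat_poles_quotient')
  qed
  show ?thesis
    using 1 2 not_in_rat_poles_inverse_iff[OF assms] by blast
qed

lemma rat_eval_inverse: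
  assumes "f \<noteq> 0" "s \<notin> rat_poles f" "s \<notin> rat_poles (inverse f)"
  shows "rat_eval (inverse f) s = inverse (rat_eval f s)"
proof -
  have "rat_eval f s * rat_eval (inverse f) s = rat_eval (f * inverse f) s"
    using assms by (simp only: rat_eval_mult not_False_eq_True)
  also have "\<dots> = 1" using assms(1) rat_eval_const[of 1 s] by simp
  finally show ?thesis by (rule inverse_unique[symmetric])
qed

section \<open>Positive functions form a convex invertible cone\<close>

lemma positive_functions_iff:
  "p \<in> positive_functions \<longleftrightarrow>
     rat_poles p \<inter> C_plus = {} \<and> (\<forall>s\<in>C_plus. Re (rat_eval p s) \<ge> 0)"
  by (simp add: positive_functions_def rat_eval_analytic_on_iff)

lemma rat_analytic_C_plus_iff: "f \<in> rat_analytic_C_plus \<longleftrightarrow> rat_poles f \<inter> C_plus = {}"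
  by (simp add: rat_analytic_C_plus_def rat_eval_analytic_on_iff)

lemma open_C_plus: "open C_plus"
  unfolding C_plus_def by (rule open_halfspace_Re_gt)

lemma connected_C_plus: "connected C_plus"
  unfolding C_plus_def by (intro convex_connected convex_halfspace_Re_gt)

text \<open>A nonzero rational function has only finitely many zeroes, whereas a nonempty open set
  is infinite.\<close>

lemma rat_eval_eq_0_on_C_plus:
  assumes "rat_poles f \<inter> C_plus = {}" "\<And>s. s \<in> C_plus \<Longrightarrow> rat_eval f s = 0"
  shows "f = 0"
proof (rule ccontr)
  assume "f \<noteq> 0"
  then have "finite (rat_zeroes f)"
    unfolding rat_zeroes_def by (intro poly_roots_finite) simp
  \<comment> \<open>Since poles are excluded, a value 0 comes from the numerator and is not the
    default value of a division by 0.\<close>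
  moreover have "C_plus \<subseteq> rat_zeroes f"
    using assms by (fastforce simp: rat_eval_def rat_zeroes_def rat_poles_def)
  ultimately have "finite C_plus" by (rule finite_subset[rotated])
  moreover have "1 \<in> C_plus" by (simp add: C_plus_def)
  ultimately show False using open_C_plus finite_imp_not_open by blast
qed

lemma positive_functions_eval_nonzero:
  assumes p: "p \<in> positive_functions" and "p \<noteq> 0" and s: "s \<in> C_plus"
  shows "rat_eval p s \<noteq> 0"
proof
  assume 0: "rat_eval p s = 0"
  have poles: "rat_poles p \<inter> C_plus = {}" and nonneg: "\<And>z. z \<in> C_plus \<Longrightarrow> Re (rat_eval p z) \<ge> 0"
    using p by (auto simp: positive_functions_iff)
  have hol: "rat_eval p holomorphic_on C_plus"
    using p analytic_imp_holomorphic by (auto simp: positive_functions_def)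
  \<comment> \<open>A constant would equal the value 0 taken at \<open>s\<close>, forcing
    \<open>p = 0\<close>.\<close>
  have "\<not> rat_eval p constant_on C_plus"
    using rat_eval_eq_0_on_C_plus[OF poles] \<open>p \<noteq> 0\<close> 0 s unfolding constant_on_def by metis
  then have "open (rat_eval p ` C_plus)"
    using open_mapping_thm[OF hol open_C_plus connected_C_plus open_C_plus] by simp
  moreover have "0 \<in> rat_eval p ` C_plus" using 0 s by force
  ultimately obtain e where e: "e > 0" "ball 0 e \<subseteq> rat_eval p ` C_plus"
    by (rule openE)
  \<comment> \<open>Any ball about 0 contains negative reals, which positivity forbids as
    values.\<close>
  have "- complex_of_real (e / 2) \<in> ball 0 e" using e(1) by simp
  then obtain z where "z \<in> C_plus" "rat_eval p z = - complex_of_real (e / 2)"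
    using e(2) by (metis imageE subsetD)
  then show False using nonneg[of z] e(1) by simp
qed

lemma positive_functions_add:
  assumes "p \<in> positive_functions" "q \<in> positive_functions"
  shows "p + q \<in> positive_functions"
proof -
  have "s \<notin> rat_poles (p + q) \<and> Re (rat_eval (p + q) s) \<ge> 0" if "s \<in> C_plus" for s
  proof -
    have "s \<notin> rat_poles p" "s \<notin> rat_poles q" "Re (rat_eval p s) \<ge> 0" "Re (rat_eval q s) \<ge> 0"
      using assms that by (auto simp: positive_functions_iff)
    then show ?thesis by (simp add: rat_poles_add rat_eval_add)
  qed
  then show ?thesis by (auto simp: positive_functions_iff)
qed

text \<open>The case \<open>t = 0\<close> serves convex combinations with a zero weight.\<close>

lemma positive_functions_scale:
  assumes "p \<in> positive_functions" "t \<ge> 0"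
  shows "rat_const (of_real t) * p \<in> positive_functions"
proof -
  have "s \<notin> rat_poles (rat_const (of_real t) * p) \<and> Re (rat_eval (rat_const (of_real t) * p) s) \<ge> 0"
    if "s \<in> C_plus" for s
  proof -
    have "s \<notin> rat_poles p" "Re (rat_eval p s) \<ge> 0"
      using assms that by (auto simp: positive_functions_iff)
    then show ?thesis
      using assms(2) rat_poles_mult[of "rat_const (of_real t)" p] by (auto simp: rat_eval_mult)
  qed
  then show ?thesis by (auto simp: positive_functions_iff)
qed

lemma rat_poles_inverse_positive:
  assumes "p \<in> positive_functions" "p \<noteq> 0"
  shows "rat_poles (inverse p) \<inter> C_plus = {}"
  using assms positive_functions_eval_nonzero[OF assms] not_in_rat_poles_inverse_iff[of p]
  by (fastforce simp: positive_functions_iff)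

text \<open>Analyticity of the inverse is the absence of zeroes, and the reciprocal of a value
  \<open>w\<close> has real part \<open>Re w / |w|^2\<close>.\<close>

lemma positive_functions_inverse:
  assumes "p \<in> positive_functions" "p \<noteq> 0"
  shows "inverse p \<in> positive_functions"
proof -
  note poles = rat_poles_inverse_positive[OF assms]
  have "Re (rat_eval (inverse p) s) \<ge> 0" if "s \<in> C_plus" for s
  proof -
    have "rat_eval (inverse p) s = inverse (rat_eval p s)"
      using assms that poles by (intro rat_eval_inverse) (auto simp: positive_functions_iff)
    moreover have "Re (rat_eval p s) \<ge> 0" using assms that by (auto simp: positive_functions_iff)
    ultimately show ?thesis by simp
  qed
  then show ?thesis using poles by (auto simp: positive_functions_iff)
qed

lemma convex_invertible_cone_positive: "convex_invertible_cone positive_functions"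
  by (simp add: convex_invertible_cone_def positive_functions_add positive_functions_scale
    positive_functions_inverse)

lemma zero_positive [simp]: "0 \<in> positive_functions"
  using rat_poles_const[of 0] rat_eval_const[of 0] by (simp add: positive_functions_iff)

section \<open>Obstruction to adjoining a function that is not positive\<close>

lemma positive_interpolation:
  assumes s: "s \<in> C_plus" and w: "Re w > 0"
  obtains p where "p \<in> positive_functions" "rat_eval p s = w" "f + p \<noteq> 0"
proof -
  \<comment> \<open>The real numbers \<open>a\<close> and \<open>b\<close> solve
    \<open>a * s + \<i> * b = w\<close>. As \<open>a > 0\<close>, the affine function
    \<open>p\<close> with these coefficients maps \<open>C_plus\<close> into itself.\<close>
  define a where "a = Re w / Re s"
  define b where "b = Im w - a * Im s"
  define p where "p = (to_fract [:\<i> * of_real b, of_real a:] :: ratfun)"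
  have a: "a > 0" using s w by (simp add: a_def C_plus_def)
  have pos: "rat_const w \<in> positive_functions" "p \<in> positive_functions"
    using a w by (auto simp: positive_functions_iff p_def C_plus_def)
  have eval: "rat_eval (rat_const w) s = w" "rat_eval p s = w"
    using s by (auto simp: p_def complex_eq_iff a_def b_def C_plus_def)
  \<comment> \<open>Two distinct candidates take the value \<open>w\<close> at \<open>s\<close>; at
    most one of them can equal \<open>- f\<close>.\<close>
  have "p \<noteq> rat_const w"
    using a by (simp add: p_def rat_const_def)
  then have "f + rat_const w \<noteq> 0 \<or> f + p \<noteq> 0"
    by (metis add_left_cancel)
  then show ?thesis using pos eval that by blast
qed

text \<open>Both maximality proofs rest on this. Keeping \<open>f + p\<close> nonzero makes it
  invertible in the cone argument, and in the convex set argument keeps it apart from the zero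
  function, which is exempt there.\<close>

lemma nonpositive_obstruction:
  assumes "f \<notin> positive_functions"
  obtains p where "p \<in> positive_functions" "f + p \<noteq> 0"
    "rat_poles (f + p) \<inter> C_plus \<noteq> {} \<or> rat_poles (inverse (f + p)) \<inter> C_plus \<noteq> {}"
proof (cases "rat_poles f \<inter> C_plus = {}")
  case True
  then obtain s where s: "s \<in> C_plus" "Re (rat_eval f s) < 0" "s \<notin> rat_poles f"
    using assms by (force simp: positive_functions_iff)
  then obtain p where p: "p \<in> positive_functions" "rat_eval p s = - rat_eval f s" "f + p \<noteq> 0"
    using positive_interpolation[of s "- rat_eval f s" f] by auto
  have "s \<notin> rat_poles p" using p(1) s(1) by (auto simp: positive_functions_iff)
  then have "s \<notin> rat_poles (f + p)" "rat_eval (f + p) s = 0"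
    using s(3) p(2) by (simp_all add: rat_poles_add rat_eval_add)
  then have "s \<in> rat_poles (inverse (f + p))"
    using not_in_rat_poles_inverse_iff[OF p(3)] by blast
  then show ?thesis using p that s(1) by blast
next
  case False
  \<comment> \<open>A pole of \<open>f\<close> is already an obstruction, so \<open>p = 0\<close>
    will do; \<open>f\<close> is nonzero because 0 is positive.\<close>
  have "f \<noteq> 0" using assms by auto
  then show ?thesis using False that[of 0] by simp
qed

section \<open>Units of the ring of rational functions analytic in \<open>C_plus\<close>\<close>

definition C_plus_units :: "ratfun set" where
  "C_plus_units =
     {h. h \<noteq> 0 \<and> rat_poles h \<inter> C_plus = {} \<and> rat_poles (inverse h) \<inter> C_plus = {}}"

lemma C_plus_units_mult: "f \<in> C_plus_units \<Longrightarrow> g \<in> C_plus_units \<Longrightarrow> f * g \<in> C_plus_units"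
  using rat_poles_mult[of f g] rat_poles_mult[of "inverse f" "inverse g"]
  unfolding C_plus_units_def by auto

lemma C_plus_units_inverse: "f \<in> C_plus_units \<Longrightarrow> inverse f \<in> C_plus_units"
  by (simp add: C_plus_units_def)

text \<open>Multiplication by \<open>inverse u\<close> undoes the factor \<open>u\<close>. This
  strips \<open>go * gm\<close> and nonzero constants from membership questions.\<close>

lemma C_plus_units_mult_iff:
  assumes "u \<in> C_plus_units"
  shows "u * f \<in> C_plus_units \<longleftrightarrow> f \<in> C_plus_units"
proof
  assume "u * f \<in> C_plus_units"
  then have "inverse u * (u * f) \<in> C_plus_units"
    by (rule C_plus_units_mult[OF C_plus_units_inverse[OF assms]])
  moreover have "u \<noteq> 0" using assms by (simp add: C_plus_units_def)
  moreover from this have "inverse u * (u * f) = f" by (simp flip: mult.assoc)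
  ultimately show "f \<in> C_plus_units" by (simp only:)
qed (rule C_plus_units_mult[OF assms])

lemma C_plus_units_const: "c \<noteq> 0 \<Longrightarrow> rat_const c \<in> C_plus_units"
  using inverse_rat_const[of c] by (auto simp: C_plus_units_def) (simp add: rat_const_def)

lemma G_o_units: "g \<in> G_o \<Longrightarrow> g \<in> C_plus_units"
  by (auto simp: G_o_iff C_plus_units_def rat_eval_analytic_on_iff)

lemma G_minus_units: "g \<in> G_minus \<Longrightarrow> g \<in> C_plus_units"
  by (force simp: G_minus_def C_plus_units_def rat_poles_inverse C_minus_def C_plus_def)

lemma positive_units: "p \<in> positive_functions \<Longrightarrow> p \<noteq> 0 \<Longrightarrow> p \<in> C_plus_units"
  using rat_poles_inverse_positive by (auto simp: C_plus_units_def positive_functions_iff)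

text \<open>After cancelling \<open>gp\<close>, poles of \<open>h\<close> are roots of
  \<open>d\<close> and poles of \<open>inverse h\<close> are roots of \<open>n\<close>. Conversely,
  the lowest terms of a unit supply \<open>n\<close> and \<open>d\<close>. Membership in
  \<open>G_tilde\<close> thus becomes a question about units.\<close>

lemma G_tilde_iff:
  assumes "gp \<noteq> 0"
  shows "gp * h \<in> G_tilde gp \<longleftrightarrow> h \<in> C_plus_units"
proof
  assume "gp * h \<in> G_tilde gp"
  then obtain n d where nd: "gp * h = to_fract n / to_fract d * gp" "n \<noteq> 0" "d \<noteq> 0"
    and n: "\<And>s. poly n s = 0 \<Longrightarrow> Re s \<le> 0" and d: "\<And>s. poly d s = 0 \<Longrightarrow> Re s \<le> 0"
    by (auto simp: G_tilde_def)
  have h: "h = to_fract n / to_fract d"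
    using nd(1) assms by (metis mult.commute mult_right_cancel)
  then have "inverse h = to_fract d / to_fract n" by simp
  then show "h \<in> C_plus_units"
    using nd(2,3) n d rat_poles_quotient[of d _ n] rat_poles_quotient[of n _ d]
    by (force simp: C_plus_units_def h C_plus_def)
next
  assume h: "h \<in> C_plus_units"
  let ?n = "fst (quot_of_fract h)" and ?d = "snd (quot_of_fract h)"
  have h0: "h \<noteq> 0" using h by (simp add: C_plus_units_def)
  have "gp * h = to_fract ?n / to_fract ?d * gp"
    by (subst quot_of_fract_repr(1)[of h]) (rule mult.commute)
  moreover have "?n \<noteq> 0" "?d \<noteq> 0" using h0 by auto
  moreover have "Re s \<le> 0" if "poly ?n s = 0" for s
    using h that rat_poles_inverse[OF h0]
    by (force simp: C_plus_units_def rat_zeroes_def C_plus_def)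
  moreover have "Re s \<le> 0" if "poly ?d s = 0" for s
    using h that by (force simp: C_plus_units_def rat_poles_def C_plus_def)
  ultimately show "gp * h \<in> G_tilde gp" unfolding G_tilde_def by blast
qed

section \<open>Maximality of the cone of positive functions\<close>

lemma positive_functions_maximal:
  assumes C: "convex_invertible_cone C" "C \<subseteq> rat_analytic_C_plus" "positive_functions \<subseteq> C"
  shows "C = positive_functions"
proof (rule ccontr)
  assume "C \<noteq> positive_functions"
  then obtain f where f: "f \<in> C" "f \<notin> positive_functions" using C(3) by blast
  obtain p where p: "p \<in> positive_functions" "f + p \<noteq> 0"
    "rat_poles (f + p) \<inter> C_plus \<noteq> {} \<or> rat_poles (inverse (f + p)) \<inter> C_plus \<noteq> {}"
    using f(2) by (rule nonpositive_obstruction)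
  \<comment> \<open>Both functions belong to \<open>C\<close>, yet one of them has a pole in
    \<open>C_plus\<close>.\<close>
  have "f + p \<in> C" "inverse (f + p) \<in> C"
    using C(1,3) f(1) p(1,2) by (auto simp: convex_invertible_cone_def)
  then show False using C(2) p(3) by (auto simp: rat_analytic_C_plus_iff subset_iff)
qed

section \<open>Convexity and maximality of \<open>G_set gp gm go\<close>\<close>

context
  fixes gp gm go :: ratfun
  assumes gp: "gp \<in> G_plus" and gm: "gm \<in> G_minus" and go: "go \<in> G_o"
begin

lemma gp_nonzero: "gp \<noteq> 0"
  using gp by (simp add: G_plus_def)

lemma unit_factor: "go * gm \<in> C_plus_units"
  by (intro C_plus_units_mult G_o_units G_minus_units gm go)

text \<open>Grouping the unit \<open>go * gm\<close> with \<open>p\<close> gives members the shape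
  that \<open>G_tilde_factor_iff\<close> handles.\<close>

lemma G_set_eq: "G_set gp gm go = (\<lambda>p. gp * (go * gm * p)) ` positive_functions"
  by (auto simp: G_set_def mult_ac)

lemma G_tilde_factor_iff: "gp * (go * gm * h) \<in> G_tilde gp \<longleftrightarrow> h \<in> C_plus_units"
  by (simp add: G_tilde_iff[OF gp_nonzero] C_plus_units_mult_iff[OF unit_factor])

lemma rat_convex_G_set: "rat_convex (G_set gp gm go)"
  unfolding rat_convex_def
proof (intro ballI allI impI)
  fix f g and u v :: real
  assume "f \<in> G_set gp gm go" "g \<in> G_set gp gm go" and uv: "u \<ge> 0" "v \<ge> 0"
  then obtain p q where p: "p \<in> positive_functions" "f = gp * (go * gm * p)"
    and q: "q \<in> positive_functions" "g = gp * (go * gm * q)"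
    by (auto simp: G_set_eq)
  have "rat_const (of_real u) * p + rat_const (of_real v) * q \<in> positive_functions"
    by (intro positive_functions_add positive_functions_scale p q uv)
  moreover have "rat_const (of_real u) * f + rat_const (of_real v) * g =
      gp * (go * gm * (rat_const (of_real u) * p + rat_const (of_real v) * q))"
    by (simp add: p q algebra_simps)
  ultimately show "rat_const (of_real u) * f + rat_const (of_real v) * g \<in> G_set gp gm go"
    by (auto simp: G_set_eq)
qed

text \<open>A nonzero member comes from a nonzero \<open>p\<close>, which is a unit. The zero
  function, coming from \<open>p = 0\<close>, lies outside \<open>G_tilde gp\<close>.\<close>

lemma G_set_subset_G_tilde: "G_set gp gm go - {0} \<subseteq> G_tilde gp"
  by (auto simp: G_set_eq G_tilde_factor_iff positive_units)

lemma G_set_obstruction: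
  assumes "\<phi> \<notin> G_set gp gm go"
  obtains \<psi> where "\<psi> \<in> G_set gp gm go" "\<phi> + \<psi> \<noteq> 0" "\<phi> + \<psi> \<notin> G_tilde gp"
proof -
  let ?g = "gp * (go * gm)"
  have g: "?g \<noteq> 0" using unit_factor gp_nonzero by (simp add: C_plus_units_def)
  \<comment> \<open>Division by the common factor turns non-membership of \<open>\<phi>\<close> into
    non-positivity of \<open>q\<close>.\<close>
  define q where "q = \<phi> / ?g"
  have \<phi>: "\<phi> = gp * (go * gm * q)" using g by (simp add: q_def)
  have "q \<notin> positive_functions" using assms \<phi> by (auto simp: G_set_eq)
  then obtain p where p: "p \<in> positive_functions" "q + p \<noteq> 0"
    "rat_poles (q + p) \<inter> C_plus \<noteq> {} \<or> rat_poles (inverse (q + p)) \<inter> C_plus \<noteq> {}"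
    by (rule nonpositive_obstruction)
  have sum: "\<phi> + gp * (go * gm * p) = gp * (go * gm * (q + p))"
    by (simp add: \<phi> algebra_simps)
  show ?thesis
  proof (rule that)
    show "gp * (go * gm * p) \<in> G_set gp gm go" using p(1) by (auto simp: G_set_eq)
    show "\<phi> + gp * (go * gm * p) \<noteq> 0" using g p(2) by (simp add: sum)
    show "\<phi> + gp * (go * gm * p) \<notin> G_tilde gp"
      using p(3) by (auto simp: sum G_tilde_factor_iff C_plus_units_def)
  qed
qed

lemma G_set_maximal:
  assumes C: "rat_convex C" "C - {0} \<subseteq> G_tilde gp" "G_set gp gm go \<subseteq> C"
  shows "C = G_set gp gm go"
proof (rule ccontr)
  assume "C \<noteq> G_set gp gm go"
  then obtain \<phi> where \<phi>: "\<phi> \<in> C" "\<phi> \<notin> G_set gp gm go" using C(3) by blast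
  obtain \<psi> where \<psi>: "\<psi> \<in> G_set gp gm go" "\<phi> + \<psi> \<noteq> 0" "\<phi> + \<psi> \<notin> G_tilde gp"
    using \<phi>(2) by (rule G_set_obstruction)
  \<comment> \<open>Convexity yields the midpoint rather than the sum. The factor 1/2 is a unit, so
    it does not affect membership in \<open>G_tilde gp\<close>.\<close>
  let ?c = "rat_const (of_real (1/2))"
  have c: "?c \<in> C_plus_units" by (intro C_plus_units_const) simp
  then have c0: "?c \<noteq> 0" by (simp add: C_plus_units_def)
  have "\<psi> \<in> C" using C(3) \<psi>(1) by (rule subsetD)
  then have "?c * \<phi> + ?c * \<psi> \<in> C"
    by (intro C(1)[unfolded rat_convex_def, rule_format] \<phi>(1)) simp_all
  then have "?c * (\<phi> + \<psi>) \<in> C" by (simp only: distrib_left)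
  \<comment> \<open>The midpoint is nonzero because \<open>\<phi> + \<psi>\<close> is, so the
    condition on \<open>C - {0}\<close> applies to it.\<close>
  then have mem: "?c * (\<phi> + \<psi>) \<in> G_tilde gp" using C(2) c0 \<psi>(2) by auto
  define h where "h = (\<phi> + \<psi>) / gp"
  have h: "\<phi> + \<psi> = gp * h" using gp_nonzero by (simp add: h_def)
  have "gp * (?c * h) \<in> G_tilde gp" using mem by (simp only: h mult_ac)
  then have "gp * h \<in> G_tilde gp"
    by (simp only: G_tilde_iff[OF gp_nonzero] C_plus_units_mult_iff[OF c])
  then show False using \<psi>(3) unfolding h by contradiction
qed

end

theorem proposition2p2:
  shows
    "(convex_invertible_cone positive_functions \<and>
      positive_functions \<subseteq> rat_analytic_C_plus \<and>
      (\<forall>C. convex_invertible_cone C \<and> C \<subseteq> rat_analytic_C_plus \<and> positive_functions \<subseteq> C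
           \<longrightarrow> C = positive_functions))
     \<and>
     (\<forall>gp\<in>G_plus. \<forall>gm\<in>G_minus. \<forall>go\<in>G_o.
        rat_convex (G_set gp gm go) \<and>
        G_set gp gm go - {0} \<subseteq> G_tilde gp \<and>
        (\<forall>C. rat_convex C \<and> C - {0} \<subseteq> G_tilde gp \<and> G_set gp gm go \<subseteq> C
             \<longrightarrow> C = G_set gp gm go) \<and>
        (\<forall>\<phi>. \<phi> \<notin> G_set gp gm go \<longrightarrow> (\<exists>\<psi>\<in>G_set gp gm go. \<phi> + \<psi> \<notin> G_tilde gp)))"
proof (intro conjI ballI)
  show "convex_invertible_cone positive_functions"
    by (rule convex_invertible_cone_positive)
  show "positive_functions \<subseteq> rat_analytic_C_plus"
    by (auto simp: positive_functions_def rat_analytic_C_plus_def)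
  show "\<forall>C. convex_invertible_cone C \<and> C \<subseteq> rat_analytic_C_plus \<and> positive_functions \<subseteq> C
          \<longrightarrow> C = positive_functions"
    using positive_functions_maximal by simp
next
  fix gp gm go
  assume g: "gp \<in> G_plus" "gm \<in> G_minus" "go \<in> G_o"
  show "rat_convex (G_set gp gm go)"
    by (rule rat_convex_G_set[OF g])
  show "G_set gp gm go - {0} \<subseteq> G_tilde gp"
    by (rule G_set_subset_G_tilde[OF g])
  show "\<forall>C. rat_convex C \<and> C - {0} \<subseteq> G_tilde gp \<and> G_set gp gm go \<subseteq> C \<longrightarrow> C = G_set gp gm go"
    using G_set_maximal[OF g] by simp
  show "\<forall>\<phi>. \<phi> \<notin> G_set gp gm go \<longrightarrow> (\<exists>\<psi>\<in>G_set gp gm go. \<phi> + \<psi> \<notin> G_tilde gp)"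
    using G_set_obstruction[OF g] by metis
qed

end
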